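(* Let $n\geq 2$. A tensor field $f\in C_c^\infty(\mathbb{R}^n;E^1(n))$ satisfies $X^1 f=0$ if and only if $f=H_1 h$ for some $h\in C_c^\infty(\mathbb{R}^n)$.
   Context: $E^1(n)=\mathbb{R}^n\otimes_{\mathrm s}\mathbb{R}^n$ is the space of symmetric $2$-tensors on $\mathbb{R}^n$ (components $a_{ij}=a_{ji}$), called elastic $1$-tensors. For $v\in\mathbb{S}^{n-1}$ the set of polarizations is $Q(v)=\mathbb{R}v\cup v^\perp\subset\mathbb{R}^n$ (the union of the line spanned by $v$ and the hyperplane orthogonal to $v$). For $f\in C_c^\infty(\mathbb{R}^n;E^1(n))$, $x\in\mathbb{R}^n$, $v\in\mathbb{S}^{n-1}$, $q\in Q(v)$ define $$X^1_{v,q}f(x)=\int_{\mathbb{R}}\sum_{i,j} f_{ij}(x+tv)\,v_i q_j\,dt .$$ One writes $X^1f=0$ if $X^1_{v,q}f(x)=0$ for all $x\in\mathbb{R}^n$, all $v\in\mathbb{S}^{n-1}$ and all $q\in Q(v)$. The operator $H_1$ maps a scalar function $h$ to its Hessian: $(H_1h)_{ij}=\partial_i\partial_j h$. *)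

theory Defs
  imports "HOL-Analysis.Analysis"
begin

(* Since the domain is finite-dimensional, it suffices that each directional
   derivative, for a fixed direction, is of class C^(k-1). *)
primrec Ck :: "nat \<Rightarrow> ('a::euclidean_space \<Rightarrow> 'b::real_normed_vector) \<Rightarrow> bool" where
  "Ck 0 g \<longleftrightarrow> continuous_on UNIV g"
| "Ck (Suc k) g \<longleftrightarrow> (\<forall>x. g differentiable (at x)) \<and>
     (\<forall>v. Ck k (\<lambda>x. frechet_derivative g (at x) v))"

definition Cc_infinity :: "('a::euclidean_space \<Rightarrow> 'b::real_normed_vector) set" where
  "Cc_infinity = {g. (\<forall>k. Ck k g) \<and> compact (closure {x. g x \<noteq> 0})}"

definition elastic1 :: "(real^'n^'n) set" where
  "elastic1 = {a. \<forall>i j. a $ i $ j = a $ j $ i}"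

definition polarizations :: "real^'n \<Rightarrow> (real^'n) set" where
  "polarizations v = span {v} \<union> orthogonal_comp {v}"

definition X1 :: "real^'n \<Rightarrow> real^'n \<Rightarrow> (real^'n \<Rightarrow> real^'n^'n) \<Rightarrow> real^'n \<Rightarrow> real" where
  "X1 v q f x =
     (LINT t|lborel. (\<Sum>i\<in>UNIV. \<Sum>j\<in>UNIV. f (x + t *\<^sub>R v) $ i $ j * v $ i * q $ j))"

definition X1_vanishes :: "(real^'n \<Rightarrow> real^'n^'n) \<Rightarrow> bool" where
  "X1_vanishes f \<longleftrightarrow> (\<forall>x. \<forall>v\<in>sphere 0 1. \<forall>q\<in>polarizations v. X1 v q f x = 0)"

definition partial_deriv :: "'n \<Rightarrow> (real^'n \<Rightarrow> real) \<Rightarrow> real^'n \<Rightarrow> real" where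
  "partial_deriv i g x = deriv (\<lambda>t. g (x + t *\<^sub>R axis i 1)) 0"

definition H1 :: "(real^'n \<Rightarrow> real) \<Rightarrow> real^'n \<Rightarrow> real^'n^'n" where
  "H1 h x = (\<chi> i j. partial_deriv i (partial_deriv j h) x)"

end

theory Submission
  imports Defs
begin

text \<open>
  Since \<open>v\<close> and its orthogonal complement span the space, \<open>X\<^sup>1 f = 0\<close> says that every column
  \<open>g\<close> of \<open>f\<close>, seen as a 1-form, has vanishing X-ray transform. Integrating over parallel lines gives
  \<open>\<integral> (g x \<bullet> v) exp (u \<bullet> x) dx = 0\<close> whenever \<open>u\<close> and \<open>v\<close> are orthogonal; integration by parts
  with \<open>v = (u \<bullet> a) b - (u \<bullet> b) a\<close> then shows that all exponential integrals of the components of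
  \<open>dg\<close> vanish, so \<open>dg = 0\<close> by the Stone-Weierstrass theorem. Hence each column is the gradient of
  a compactly supported potential. By the symmetry of \<open>f\<close> the vector of these potentials is again
  a closed 1-form, and its potential is \<open>h\<close>. The converse is the fundamental theorem of calculus
  along lines.
\<close>

section \<open>Volume integrals as averages of line integrals\<close>

lemma integrable_compact_support:
  fixes F :: "'a::euclidean_space \<Rightarrow> real"
  assumes "continuous_on UNIV F" "bounded {x. F x \<noteq> 0}"
  shows "integrable lborel F"
proof -
  obtain R where R: "\<And>x. F x \<noteq> 0 \<Longrightarrow> x \<in> cball 0 R"
    using assms(2) by (auto simp: bounded_iff)
  have "integrable lborel (\<lambda>x. indicator (cball 0 R) x *\<^sub>R F x)"
    by (intro borel_integrable_compact continuous_on_subset[OF assms(1)]) auto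
  also have "(\<lambda>x. indicator (cball 0 R) x *\<^sub>R F x) = F"
    using R by (force simp: indicator_def)
  finally show ?thesis .
qed

text \<open>The lines in direction \<^term>\<open>v\<close> spend exactly unit time in the slab
  \<open>0 \<le> x \<bullet> v \<le> v \<bullet> v\<close>, so averaging over it turns a volume integral into line integrals.\<close>

lemma integral_zero_if_line_integrals_zero:
  fixes F :: "'a::euclidean_space \<Rightarrow> real"
  assumes F: "continuous_on UNIV F" "bounded {x. F x \<noteq> 0}"
    and v: "v \<noteq> 0"
    and line: "\<And>x. (LINT t|lborel. F (x + t *\<^sub>R v)) = 0"
  shows "(LINT x|lborel. F x) = 0"
proof -
  obtain R where R: "\<And>x. F x \<noteq> 0 \<Longrightarrow> norm x \<le> R"
    using assms(2) by (auto simp: bounded_iff)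
  define S where "S = {x. 0 \<le> x \<bullet> v \<and> x \<bullet> v \<le> v \<bullet> v}"
  \<comment> \<open>If \<open>norm y\<close> is at most \<open>R\<close> and \<open>y - t v\<close>
    lies in the slab, then |t| |v|^2 is at most R |v| + |v|^2; dividing by |v|^2 gives this
    bound.\<close>
  define T where "T = R / norm v + 1"
  have vv: "v \<bullet> v > 0" and nv: "norm v > 0" using v by auto
  have T: "t \<in> cbox (-T) T" if "F y \<noteq> 0" "y - t *\<^sub>R v \<in> S" for y t
  proof -
    have "\<bar>y \<bullet> v\<bar> \<le> R * norm v"
      using Cauchy_Schwarz_ineq2[of y v] R[OF that(1)]
      by (meson mult_right_mono norm_ge_zero order_trans)
    with that(2) have "\<bar>t * (v \<bullet> v)\<bar> \<le> R * norm v + v \<bullet> v"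
      by (auto simp: S_def inner_diff_left)
    then have "\<bar>t\<bar> * (v \<bullet> v) \<le> R * norm v + v \<bullet> v"
      by (simp add: abs_mult)
    also have "\<dots> = T * (v \<bullet> v)"
      using nv by (simp add: T_def algebra_simps dot_square_norm power2_eq_square)
    finally show ?thesis using vv by auto
  qed
  \<comment> \<open>Fubini needs integrability on the product. The slab indicator destroys
    continuity, but each integrand equals a continuous function cut off to a compact set:
    \<open>A\<close> before the shift by \<open>t v\<close>, \<open>B\<close> after it.\<close>
  define A where "A = {z::'a \<times> real. fst z - snd z *\<^sub>R v \<in> S} \<inter> (cball 0 R \<times> cbox (-T) T)"
  define B where "B = {z::'a \<times> real. fst z \<in> S} \<inter> (cball 0 (R + \<bar>T\<bar> * norm v) \<times> cbox (-T) T)"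
  have "closed {z::'a \<times> real. fst z - snd z *\<^sub>R v \<in> S}"
    unfolding S_def mem_Collect_eq
    by (intro closed_Collect_conj closed_Collect_le continuous_intros)
  then have cA: "compact A" unfolding A_def
    by (intro closed_Int_compact compact_Times) auto
  have "closed {z::'a \<times> real. fst z \<in> S}"
    unfolding S_def mem_Collect_eq
    by (intro closed_Collect_conj closed_Collect_le continuous_intros)
  then have cB: "compact B" unfolding B_def
    by (intro closed_Int_compact compact_Times) auto
  have "integrable lborel (\<lambda>z. indicator A z *\<^sub>R F (fst z))"
    using F(1) by (intro borel_integrable_compact cA)
      (auto intro!: continuous_intros intro: continuous_on_compose2)
  also have "(\<lambda>z. indicator A z *\<^sub>R F (fst z)) = (\<lambda>(y, t). F y * indicator S (y - t *\<^sub>R v))"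
    using R T by (force simp: A_def fun_eq_iff indicator_def)
  finally have iA: "integrable (lborel \<Otimes>\<^sub>M lborel) (\<lambda>(y, t). F y * indicator S (y - t *\<^sub>R v))"
    by (simp add: lborel_prod)
  have "integrable lborel (\<lambda>z. indicator B z *\<^sub>R F (fst z + snd z *\<^sub>R v))"
    by (intro borel_integrable_compact cB continuous_on_compose2[OF F(1)])
      (auto intro!: continuous_intros)
  also have "(\<lambda>z. indicator B z *\<^sub>R F (fst z + snd z *\<^sub>R v)) =
      (\<lambda>(x, t). F (x + t *\<^sub>R v) * indicator S x)"
  proof -
    have "(x, t) \<in> B" if "F (x + t *\<^sub>R v) \<noteq> 0" "x \<in> S" for x t
    proof -
      have t: "t \<in> cbox (-T) T" using T[of "x + t *\<^sub>R v" t] that by simp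
      have "norm x \<le> norm (x + t *\<^sub>R v) + norm (t *\<^sub>R v)"
        by (metis add_diff_cancel_right' norm_triangle_ineq4)
      also have "\<dots> \<le> R + \<bar>T\<bar> * norm v"
        using R[OF that(1)] t by (intro add_mono) (auto intro!: mult_right_mono)
      finally show ?thesis using t that by (auto simp: B_def)
    qed
    then show ?thesis by (force simp: B_def fun_eq_iff indicator_def)
  qed
  finally have iB: "integrable (lborel \<Otimes>\<^sub>M lborel) (\<lambda>(x, t). F (x + t *\<^sub>R v) * indicator S x)"
    by (simp add: lborel_prod)
  have slab: "(LINT t|lborel. indicator S (y - t *\<^sub>R v)) = (1::real)" for y
  proof -
    have "(\<lambda>t. indicator S (y - t *\<^sub>R v)) =
        (indicator {(y \<bullet> v) / (v \<bullet> v) - 1 .. (y \<bullet> v) / (v \<bullet> v)} :: real \<Rightarrow> real)"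
      using vv by (auto simp: fun_eq_iff S_def indicator_def inner_diff_left field_simps)
    then show ?thesis by simp
  qed
  have translate: "(LINT x|lborel. F (x + t *\<^sub>R v) * indicator S x) =
      (LINT y|lborel. F y * indicator S (y - t *\<^sub>R v))" for t
  proof -
    have [measurable]: "F \<in> borel_measurable borel" "S \<in> sets borel"
      using F(1) by (auto intro!: borel_measurable_continuous_onI borel_closed
          closed_Collect_conj closed_Collect_le continuous_intros simp: S_def)
    have "(LINT y|lborel. F y * indicator S (y - t *\<^sub>R v)) =
        (LINT y|distr lborel borel ((+) (t *\<^sub>R v)). F y * indicator S (y - t *\<^sub>R v))"
      by (simp add: lborel_distr_plus)
    also have "\<dots> = (LINT x|lborel. F (t *\<^sub>R v + x) * indicator S (t *\<^sub>R v + x - t *\<^sub>R v))"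
      by (intro integral_distr) auto
    finally show ?thesis by (simp add: add.commute)
  qed
  \<comment> \<open>Insert the factor 1 from \<open>slab\<close>, exchange the integrals, translate
    by \<open>t v\<close>, and exchange back: for fixed \<open>x\<close> the inner integral is now a
    full line integral.\<close>
  have "(LINT y|lborel. F y) = (LINT y|lborel. LINT t|lborel. F y * indicator S (y - t *\<^sub>R v))"
    by (simp add: slab)
  also have "\<dots> = (LINT t|lborel. LINT y|lborel. F y * indicator S (y - t *\<^sub>R v))"
    using lborel_pair.Fubini_integral[OF iA] by simp
  also have "\<dots> = (LINT t|lborel. LINT x|lborel. F (x + t *\<^sub>R v) * indicator S x)"
    by (simp add: translate)
  also have "\<dots> = (LINT x|lborel. LINT t|lborel. F (x + t *\<^sub>R v) * indicator S x)"
    using lborel_pair.Fubini_integral[OF iB] by simp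
  also have "\<dots> = 0" by (simp add: line)
  finally show ?thesis .
qed

section \<open>Exponential sums and injectivity of the Laplace transform\<close>

text \<open>Since a product of two exponentials is again an exponential, with the exponents added,
  this class is an algebra; \<open>u = 0\<close> supplies the constants. Stone-Weierstrass therefore
  applies to it.\<close>

inductive exp_sum :: "('a::real_inner \<Rightarrow> real) \<Rightarrow> bool" where
  single: "exp_sum (\<lambda>x. c * exp (u \<bullet> x))"
| plus: "exp_sum p \<Longrightarrow> exp_sum q \<Longrightarrow> exp_sum (\<lambda>x. p x + q x)"

lemma exp_sum_mult_single:
  assumes "exp_sum p"
  shows "exp_sum (\<lambda>x. p x * (c * exp (u \<bullet> x)))"
  using assms
proof induction
  case (single d w)
  then show ?case
    using exp_sum.single[of "d * c" "w + u"] by (simp add: inner_add_left exp_add mult_ac)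
qed (auto simp: distrib_right intro: exp_sum.plus)

lemma exp_sum_mult:
  assumes "exp_sum p" "exp_sum q"
  shows "exp_sum (\<lambda>x. p x * q x)"
  using assms(2)
  by induction (auto simp: distrib_left assms(1) intro: exp_sum.plus exp_sum_mult_single)

lemma exp_sum_continuous: "exp_sum p \<Longrightarrow> continuous_on S p"
  by (induction rule: exp_sum.induct) (auto intro!: continuous_intros)

text \<open>Injectivity of the Laplace transform: exponentials span a dense algebra of functions.\<close>

lemma zero_if_exp_integrals_zero:
  fixes w :: "'a::euclidean_space \<Rightarrow> real"
  assumes w: "continuous_on UNIV w" "bounded {x. w x \<noteq> 0}"
    and zero: "\<And>u. (LINT x|lborel. w x * exp (u \<bullet> x)) = 0"
  shows "w x = 0"
proof -
  obtain R where R: "\<And>x. w x \<noteq> 0 \<Longrightarrow> norm x \<le> R"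
    using assms(2) by (auto simp: bounded_iff)
  have int: "integrable lborel (\<lambda>x. w x * p x)" if "continuous_on UNIV p" for p :: "'a \<Rightarrow> real"
    using w that by (intro integrable_compact_support)
      (auto intro!: continuous_intros intro: bounded_subset)
  have int0: "(LINT x|lborel. w x * p x) = 0" if "exp_sum p" for p
    using that
  proof induction
    case (single c u)
    have "(LINT x|lborel. w x * (c * exp (u \<bullet> x))) = c * (LINT x|lborel. w x * exp (u \<bullet> x))"
      by (simp add: mult.left_commute)
    then show ?case by (simp add: zero)
  next
    case (plus p q)
    then show ?case by (simp add: distrib_left int exp_sum_continuous)
  qed
  define N where "N = (LINT x|lborel. \<bar>w x\<bar>)"
  have iw: "integrable lborel w" using w by (rule integrable_compact_support)
  \<comment> \<open>Every exponential sum \<open>p\<close> integrates to zero against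
    \<open>w\<close>, so the integral of w^2 is that of w (w - p), and \<open>p\<close> may be
    chosen uniformly within \<open>e\<close> of \<open>w\<close> on a ball outside which
    \<open>w\<close> vanishes.\<close>
  have approx: "(LINT x|lborel. w x * w x) \<le> e * N" if "e > 0" for e
  proof -
    have "\<exists>p. exp_sum p \<and> (\<forall>x\<in>cball 0 R. \<bar>w x - p x\<bar> < e)"
    proof (rule Stone_Weierstrass_HOL[where P = exp_sum])
      show "exp_sum (\<lambda>x. c)" for c using exp_sum.single[of c 0] by simp
      show "\<exists>f. exp_sum f \<and> f x \<noteq> f y" if "x \<in> cball 0 R \<and> y \<in> cball 0 R \<and> x \<noteq> y" for x y
      proof (intro exI conjI)
        \<comment> \<open>The exponent \<open>x - y\<close> separates the points because (x - y) .
          (x - y) is nonzero.\<close>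
        show "exp_sum (\<lambda>z. 1 * exp ((x - y) \<bullet> z))" by (rule exp_sum.single)
        show "1 * exp ((x - y) \<bullet> x) \<noteq> 1 * exp ((x - y) \<bullet> y)"
          using that inner_eq_zero_iff[of "x - y"] by (simp add: inner_diff_right)
      qed
    qed (use \<open>e > 0\<close> w in \<open>auto intro: exp_sum_continuous exp_sum.plus exp_sum_mult continuous_on_subset\<close>)
    then obtain p where p: "exp_sum p" "\<And>x. norm x \<le> R \<Longrightarrow> \<bar>w x - p x\<bar> < e"
      by auto
    have "(LINT x|lborel. w x * w x) = (LINT x|lborel. w x * w x) - (LINT x|lborel. w x * p x)"
      by (simp add: int0 p)
    also have "\<dots> = (LINT x|lborel. w x * w x - w x * p x)"
      using int w exp_sum_continuous[OF p(1)] by (intro Bochner_Integration.integral_diff[symmetric]) auto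
    also have "\<dots> \<le> (LINT x|lborel. e * \<bar>w x\<bar>)"
    proof (rule integral_mono)
      show "integrable lborel (\<lambda>x. w x * w x - w x * p x)"
        using int w exp_sum_continuous[OF p(1)] by auto
      show "integrable lborel (\<lambda>x. e * \<bar>w x\<bar>)" using iw by auto
      show "w x * w x - w x * p x \<le> e * \<bar>w x\<bar>" for x
      proof (cases "w x = 0")
        case False
        then have "\<bar>w x - p x\<bar> \<le> e" using R p(2) by (meson less_imp_le)
        then have "\<bar>w x\<bar> * \<bar>w x - p x\<bar> \<le> \<bar>w x\<bar> * e" by (rule mult_left_mono) auto
        then show ?thesis by (simp flip: abs_mult add: algebra_simps)
      qed auto
    qed
    finally show ?thesis by (simp add: N_def)
  qed
  have "(LINT x|lborel. w x * w x) \<le> 0"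
  proof (rule field_le_epsilon)
    fix e :: real assume "e > 0"
    have "N \<ge> 0" by (simp add: N_def)
    \<comment> \<open>Dividing by \<open>N + 1\<close> rather than \<open>N\<close> covers the case
      \<open>N = 0\<close>.\<close>
    then have "e / (N + 1) * N \<le> e" using \<open>e > 0\<close> by (simp add: field_simps)
    with approx[of "e / (N + 1)"] \<open>e > 0\<close> \<open>N \<ge> 0\<close>
    show "(LINT x|lborel. w x * w x) \<le> 0 + e" by (simp add: add_nonneg_pos)
  qed
  moreover have "(LINT x|lborel. w x * w x) \<ge> 0" by simp
  ultimately have "AE x in lborel. w x * w x = 0"
    using int[OF w(1)] by (subst integral_nonneg_eq_0_iff_AE[symmetric]) auto
  \<comment> \<open>The zero set of \<open>w\<close> is closed and has full measure, so it is the
    whole space.\<close>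
  then have "AE x \<in> UNIV in lebesgue. x \<in> {x. w x = 0}"
    by (auto intro: AE_completion)
  moreover have "closed {x. w x = 0}"
    using w by (intro closed_Collect_eq continuous_intros)
  ultimately show ?thesis
    using mem_closed_if_AE_lebesgue_open[of UNIV "{x. w x = 0}" x] by auto
qed

section \<open>Calculus of smooth compactly supported maps\<close>

lemma frechet_derivative_eqI:
  "(f has_derivative f') (at x) \<Longrightarrow> frechet_derivative f (at x) = f'"
  using frechet_derivative_at by metis

lemma Ck_continuous: "Ck k g \<Longrightarrow> continuous_on S g"
  by (cases k) (auto intro: continuous_on_subset differentiable_imp_continuous_on
      simp: differentiable_on_def differentiable_at_withinI)

lemma Ck_SucI:
  assumes "\<And>x. (g has_derivative D x) (at x)" "\<And>v. Ck k (\<lambda>x. D x v)"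
  shows "Ck (Suc k) g"
proof -
  have "frechet_derivative g (at x) = D x" for x
    using assms(1) by (rule frechet_derivative_eqI)
  with assms show ?thesis by (auto simp: differentiable_def)
qed

lemma Ck_bounded_linear:
  assumes L: "bounded_linear L"
  shows "Ck k g \<Longrightarrow> Ck k (\<lambda>x. L (g x))"
proof (induction k arbitrary: g)
  case 0
  then show ?case
    by (auto intro: continuous_intros bounded_linear.continuous_on[OF L])
next
  case (Suc k)
  then have "(g has_derivative frechet_derivative g (at x)) (at x)" for x
    by (simp flip: frechet_derivative_works)
  then have "((\<lambda>x. L (g x)) has_derivative (\<lambda>v. L (frechet_derivative g (at x) v))) (at x)" for x
    by (rule bounded_linear.has_derivative[OF L])
  with Suc show ?case by (intro Ck_SucI) auto
qed

lemma Cc_infinity_iff: "g \<in> Cc_infinity \<longleftrightarrow> (\<forall>k. Ck k g) \<and> bounded {x. g x \<noteq> 0}"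
  by (auto simp: Cc_infinity_def compact_closure)

text \<open>Suited to potentials: their derivative is given explicitly, so \<open>Ck_SucI\<close>
  yields the successor orders, and order 0 is the continuity that these imply.\<close>

lemma Cc_infinityI:
  assumes "\<And>k. Ck (Suc k) g" "bounded {x. g x \<noteq> 0}"
  shows "g \<in> Cc_infinity"
proof -
  have "Ck k g" for k
    using assms(1) by (cases k) (auto intro: Ck_continuous simp del: Ck.simps(2))
  with assms(2) show ?thesis by (simp add: Cc_infinity_iff)
qed

lemma Cc_infinity_has_derivative:
  "g \<in> Cc_infinity \<Longrightarrow> (g has_derivative frechet_derivative g (at x)) (at x)"
  unfolding Cc_infinity_iff by (metis Ck.simps(2) frechet_derivative_works)

text \<open>On the open complement of the closed support, \<open>P\<close> is locally zero and so is
  its derivative; taking the closure preserves boundedness.\<close>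

lemma bounded_support_derivative:
  assumes der: "\<And>x. (P has_derivative P' x) (at x)" and bd: "bounded {x. P x \<noteq> 0}"
  shows "bounded {x. P' x a \<noteq> 0}"
proof (rule bounded_subset)
  show "bounded (closure {x. P x \<noteq> 0})" using bd by (rule bounded_closure)
  show "{x. P' x a \<noteq> 0} \<subseteq> closure {x. P x \<noteq> 0}"
  proof (rule ccontr)
    assume "\<not> ?thesis"
    then obtain x where x: "P' x a \<noteq> 0" "x \<in> - closure {x. P x \<noteq> 0}" by auto
    have "((\<lambda>_. 0) has_derivative P' x) (at x)"
      by (rule has_derivative_transform_within_open[OF der, where s = "- closure {x. P x \<noteq> 0}"])
        (use x closure_subset[of "{x. P x \<noteq> 0}"] in auto)
    then have "P' x = (\<lambda>_. 0)" by (rule has_derivative_unique) simp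
    with x show False by simp
  qed
qed

lemma Cc_infinity_derivative:
  assumes "g \<in> Cc_infinity"
  shows "(\<lambda>x. frechet_derivative g (at x) a) \<in> Cc_infinity"
proof -
  have "Ck k (\<lambda>x. frechet_derivative g (at x) a)" for k
    using assms Ck.simps(2)[of k g] by (auto simp: Cc_infinity_iff simp del: Ck.simps)
  then show ?thesis
    using bounded_support_derivative[OF Cc_infinity_has_derivative[OF assms]] assms
    by (simp add: Cc_infinity_iff)
qed

lemma Cc_infinity_bounded_linear:
  assumes "g \<in> Cc_infinity" "bounded_linear L"
  shows "(\<lambda>x. L (g x)) \<in> Cc_infinity"
proof -
  have "{x. L (g x) \<noteq> 0} \<subseteq> {x. g x \<noteq> 0}"
    using linear_0[OF bounded_linear.linear[OF assms(2)]] by auto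
  with assms show ?thesis
    by (auto simp: Cc_infinity_iff intro: Ck_bounded_linear bounded_subset)
qed

section \<open>Restriction to lines and integration by parts\<close>

lemma bounded_support_line:
  fixes P :: "'a::real_normed_vector \<Rightarrow> 'b::zero"
  assumes "bounded {x. P x \<noteq> 0}" "a \<noteq> 0"
  shows "bounded {t::real. P (x + t *\<^sub>R a) \<noteq> 0}"
proof -
  obtain R where R: "\<And>x. P x \<noteq> 0 \<Longrightarrow> norm x \<le> R"
    using assms(1) by (auto simp: bounded_iff)
  have "\<bar>t\<bar> \<le> (R + norm x) / norm a" if "P (x + t *\<^sub>R a) \<noteq> 0" for t
  proof -
    have "norm (t *\<^sub>R a) \<le> norm (x + t *\<^sub>R a) + norm x"
      by (metis add_diff_cancel_left' norm_triangle_ineq4)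
    also have "\<dots> \<le> R + norm x" using R[OF that] by simp
    finally show ?thesis using assms(2) by (simp add: pos_le_divide_eq)
  qed
  then show ?thesis by (auto simp: bounded_iff)
qed

lemma has_real_derivative_along_line:
  assumes "(P has_derivative P') (at (x + t *\<^sub>R a))"
  shows "((\<lambda>t. P (x + t *\<^sub>R a)) has_real_derivative P' a) (at t)"
proof -
  have "((\<lambda>t. x + t *\<^sub>R a) has_derivative (\<lambda>h. h *\<^sub>R a)) (at t)"
    by (auto intro!: derivative_eq_intros)
  from has_derivative_compose[OF this assms]
  have "((\<lambda>t. P (x + t *\<^sub>R a)) has_derivative (\<lambda>h. P' (h *\<^sub>R a))) (at t)" .
  moreover have "(\<lambda>h. P' (h *\<^sub>R a)) = (*) (P' a)"
    by (simp add: fun_eq_iff linear_cmul[OF has_derivative_linear[OF assms]])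
  ultimately show ?thesis by (simp add: has_field_derivative_def)
qed

text \<open>The integrand is the \<open>t\<close>-derivative of \<open>P (x + t a)\<close>, which
  vanishes for large |t|; the fundamental theorem of calculus leaves only zero boundary
  terms.\<close>

lemma line_integral_derivative_zero:
  fixes P :: "'a::euclidean_space \<Rightarrow> real"
  assumes der: "\<And>x. (P has_derivative P' x) (at x)"
    and cont: "continuous_on UNIV (\<lambda>x. P' x a)" and bd: "bounded {x. P x \<noteq> 0}"
  shows "(LINT t|lborel. P' (x + t *\<^sub>R a) a) = 0"
proof (cases "a = 0")
  case True
  then show ?thesis
    using linear_0[OF has_derivative_linear[OF der]] by simp
next
  case False
  let ?p = "\<lambda>t. P (x + t *\<^sub>R a)" and ?p' = "\<lambda>t. P' (x + t *\<^sub>R a) a"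
  have "bounded ({t. ?p t \<noteq> 0} \<union> {t. ?p' t \<noteq> 0})"
    using False bd bounded_support_line[OF bounded_support_derivative[OF der bd], of a x a]
    by (auto intro: bounded_support_line)
  then obtain T where "T > 0" and T: "\<And>t. ?p t \<noteq> 0 \<or> ?p' t \<noteq> 0 \<Longrightarrow> \<bar>t\<bar> \<le> T"
    by (auto simp: bounded_pos)
  have deriv: "(?p has_real_derivative ?p' t) (at t)" for t
    using der by (rule has_real_derivative_along_line)
  have "continuous_on UNIV ?p'"
    by (rule continuous_on_compose2[OF cont]) (auto intro!: continuous_intros)
  then have "isCont ?p' t" for t
    by (simp add: continuous_on_eq_continuous_at)
  \<comment> \<open>\<open>T\<close> is only a weak bound for the supports, so the endpoints are
    moved to \<open>T + 1\<close>, where the primitive certainly vanishes.\<close>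
  with deriv \<open>T > 0\<close> have "(LINT t|lborel. ?p' t * indicator {- (T + 1)..T + 1} t) = ?p (T + 1) - ?p (- (T + 1))"
    by (intro integral_FTC_Icc_real) auto
  moreover have "?p (T + 1) = 0" "?p (- (T + 1)) = 0"
    using T[of "T + 1"] T[of "- (T + 1)"] \<open>T > 0\<close> by linarith+
  moreover have "(\<lambda>t. ?p' t * indicator {- (T + 1)..T + 1} t) = ?p'"
  proof
    show "?p' t * indicator {- (T + 1)..T + 1} t = ?p' t" for t
      using T[of t] by (cases "?p' t = 0") (auto simp: indicator_def abs_le_iff)
  qed
  ultimately show ?thesis by simp
qed

text \<open>Integration by parts in a form free of coordinates: all line integrals in direction
  \<open>a\<close> vanish, hence so does the volume integral.\<close>

lemma integral_derivative_zero:
  fixes P :: "'a::euclidean_space \<Rightarrow> real"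
  assumes der: "\<And>x. (P has_derivative P' x) (at x)"
    and cont: "continuous_on UNIV (\<lambda>x. P' x a)" and bd: "bounded {x. P x \<noteq> 0}"
  shows "(LINT x|lborel. P' x a) = 0"
proof (cases "a = 0")
  case True
  then show ?thesis
    using linear_0[OF has_derivative_linear[OF der]] by simp
next
  case False
  show ?thesis
    using cont bounded_support_derivative[OF der bd] False line_integral_derivative_zero[OF der cont bd]
    by (rule integral_zero_if_line_integrals_zero)
qed

section \<open>1-forms: closedness from the X-ray transform, and compactly supported
  potentials\<close>

lemma symmetric_derivative_if_Xray_zero:
  fixes g :: "'a::euclidean_space \<Rightarrow> 'a"
  assumes g: "g \<in> Cc_infinity"
    and xray: "\<And>x v. norm v = 1 \<Longrightarrow> (LINT t|lborel. g (x + t *\<^sub>R v) \<bullet> v) = 0"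
  shows "frechet_derivative g (at x) a \<bullet> b = frechet_derivative g (at x) b \<bullet> a"
proof -
  define D where "D x = frechet_derivative g (at x)" for x
  have der: "(g has_derivative D x) (at x)" for x
    unfolding D_def by (rule Cc_infinity_has_derivative[OF g])
  have contg: "continuous_on UNIV g" and bdg: "bounded {x. g x \<noteq> 0}"
    using g by (auto simp: Cc_infinity_iff intro: Ck_continuous)
  have contD: "continuous_on UNIV (\<lambda>x. D x h)" and bdD: "bounded {x. D x h \<noteq> 0}" for h
    using Cc_infinity_derivative[OF g, of h] unfolding D_def
    by (auto simp: Cc_infinity_iff intro: Ck_continuous)
  \<comment> \<open>The directions used below are not normalised; substituting
    \<open>t / norm v\<close> for \<open>t\<close> reduces to the unit vector
    \<open>sgn v\<close>.\<close>
  have xray': "(LINT t|lborel. g (x + t *\<^sub>R v) \<bullet> v) = 0" if "v \<noteq> 0" for x v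
  proof -
    have "(LINT t|lborel. g (x + t *\<^sub>R v) \<bullet> v) =
        \<bar>1 / norm v\<bar> *\<^sub>R (LINT t|lborel. g (x + (0 + 1 / norm v * t) *\<^sub>R v) \<bullet> v)"
      using that by (intro lborel_integral_real_affine) auto
    also have "(LINT t|lborel. g (x + (0 + 1 / norm v * t) *\<^sub>R v) \<bullet> v) =
        (LINT t|lborel. norm v * (g (x + t *\<^sub>R sgn v) \<bullet> sgn v))"
      using that by (simp add: sgn_div_norm divide_inverse mult.commute)
    also have "\<dots> = 0" using xray[of "sgn v" x] that by (simp add: norm_sgn)
    finally show ?thesis by simp
  qed
  \<comment> \<open>This is the exterior derivative of the 1-form \<open>g\<close>, evaluated on the
    pair \<open>a\<close>, \<open>b\<close>.\<close>
  define w where "w x = D x a \<bullet> b - D x b \<bullet> a" for x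
  have contw: "continuous_on UNIV w"
    unfolding w_def by (intro continuous_intros contD)
  have bdw: "bounded {x. w x \<noteq> 0}"
    by (rule bounded_subset[OF bounded_Un[THEN iffD2, OF conjI[OF bdD[of a] bdD[of b]]]])
      (auto simp: w_def)
  have bdi: "bounded {x. g x \<bullet> c * q x \<noteq> 0}" for c and q :: "'a \<Rightarrow> real"
    by (rule bounded_subset[OF bdg]) auto
  have "(LINT x|lborel. w x * exp (u \<bullet> x)) = 0" for u
  proof -
    define P' where "P' c x h = (D x h \<bullet> c) * exp (u \<bullet> x) + (g x \<bullet> c) * ((u \<bullet> h) * exp (u \<bullet> x))" for c x h
    have P: "((\<lambda>x. (g x \<bullet> c) * exp (u \<bullet> x)) has_derivative P' c x) (at x)" for c x
      unfolding P'_def using der[of x] by (auto intro!: derivative_eq_intros simp: algebra_simps)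
    have contP: "continuous_on UNIV (\<lambda>x. P' c x h)" for c h
      unfolding P'_def by (intro continuous_intros contD contg)
    have intP: "(LINT x|lborel. P' c x h) = 0" "integrable lborel (\<lambda>x. P' c x h)" for c h
      using integral_derivative_zero[OF P contP bdi]
        integrable_compact_support[OF contP bounded_support_derivative[OF P bdi]] by auto
    \<comment> \<open>Integrating by parts in both terms of \<open>w\<close> moves the derivatives
      onto the exponential. The resulting factors \<open>u \<bullet> a\<close> and
      \<open>u \<bullet> b\<close> combine into the pairing of \<open>g\<close> with this
      vector.\<close>
    define v where "v = (u \<bullet> a) *\<^sub>R b - (u \<bullet> b) *\<^sub>R a"
    have uv: "u \<bullet> v = 0" by (simp add: v_def inner_diff_right)
    define F where "F x = g x \<bullet> v * exp (u \<bullet> x)" for x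
    have contF: "continuous_on UNIV F" unfolding F_def by (intro continuous_intros contg)
    have bdF: "bounded {x. F x \<noteq> 0}" unfolding F_def by (rule bdi)
    have intF: "(LINT x|lborel. F x) = 0"
    proof (cases "v = 0")
      case False
      \<comment> \<open>As \<open>u\<close> is orthogonal to \<open>v\<close>, the exponential is
        constant on lines in direction \<open>v\<close> and factors out of the line
        integral.\<close>
      then show ?thesis
        by (intro integral_zero_if_line_integrals_zero[OF contF bdF])
          (auto simp: F_def inner_add_right uv xray')
    qed (simp add: F_def)
    have "w x * exp (u \<bullet> x) = P' b x a - P' a x b - F x" for x
      by (simp add: w_def P'_def F_def v_def algebra_simps)
    then show ?thesis
      using intP intF integrable_compact_support[OF contF bdF] by simp
  qed
  from zero_if_exp_integrals_zero[OF contw bdw this] show ?thesis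
    by (simp add: w_def D_def)
qed

text \<open>Outside a ball a compactly supported closed 1-form vanishes, and in dimension at least 2 the
  complement of a ball is connected; so the radial primitive is constant there.\<close>

lemma compactly_supported_potential:
  fixes g :: "'a::euclidean_space \<Rightarrow> 'a"
  assumes g: "g \<in> Cc_infinity" and dim: "DIM('a) \<ge> 2"
    and sym: "\<And>x a b. frechet_derivative g (at x) a \<bullet> b = frechet_derivative g (at x) b \<bullet> a"
  obtains p where "p \<in> Cc_infinity" "\<And>x. (p has_derivative (\<lambda>h. g x \<bullet> h)) (at x)"
proof -
  define D where "D x = frechet_derivative g (at x)" for x
  have der: "(g has_derivative D x) (at x)" for x
    unfolding D_def by (rule Cc_infinity_has_derivative[OF g])
  have contg: "continuous_on UNIV g" and bdg: "bounded {x. g x \<noteq> 0}"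
    using g by (auto simp: Cc_infinity_iff intro: Ck_continuous)
  have contD: "continuous_on UNIV (\<lambda>x. D x h)" for h
    using Cc_infinity_derivative[OF g, of h] unfolding D_def
    by (auto simp: Cc_infinity_iff intro: Ck_continuous)
  \<comment> \<open>The Poincare primitive: the integral of the 1-form \<open>g\<close> along the
    segment from 0 to \<open>x\<close>. Below, \<open>E x t\<close> is the derivative of its
    integrand in \<open>x\<close>.\<close>
  define q where "q x = integral (cbox 0 1) (\<lambda>t::real. g (t *\<^sub>R x) \<bullet> x)" for x
  define E where "E x t h = t * (D (t *\<^sub>R x) h \<bullet> x) + g (t *\<^sub>R x) \<bullet> h" for x h and t :: real
  have derE: "((\<lambda>x. g (t *\<^sub>R x) \<bullet> x) has_derivative E x t) (at x)" for x t
  proof -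
    have "((\<lambda>x. g (t *\<^sub>R x)) has_derivative (\<lambda>h. D (t *\<^sub>R x) (t *\<^sub>R h))) (at x)"
      by (rule has_derivative_compose[OF _ der]) (auto intro!: derivative_eq_intros)
    then have "((\<lambda>x. g (t *\<^sub>R x) \<bullet> x) has_derivative
        (\<lambda>h. g (t *\<^sub>R x) \<bullet> h + D (t *\<^sub>R x) (t *\<^sub>R h) \<bullet> x)) (at x)"
      by (rule has_derivative_inner) auto
    then show ?thesis
      using linear_cmul[OF has_derivative_linear[OF der]] by (simp add: E_def[abs_def] add.commute)
  qed
  \<comment> \<open>The Leibniz rule takes the derivative as a bounded linear function depending
    continuously on \<open>(x, t)\<close>, hence the wrapping in \<open>Blinfun\<close>.\<close>
  have blE: "blinfun_apply (Blinfun (E x t)) = E x t" for x t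
    using derE by (intro bounded_linear_Blinfun_apply has_derivative_bounded_linear)
  have contE: "continuous_on S (\<lambda>(x, t). Blinfun (E x t))" for S
    unfolding case_prod_unfold
  proof (rule continuous_on_blinfun_componentwise)
    fix i :: 'a
    show "continuous_on S (\<lambda>z. blinfun_apply (Blinfun (E (fst z) (snd z))) i)"
      unfolding blE E_def
      by (intro continuous_intros continuous_on_compose2[OF contD] continuous_on_compose2[OF contg]) auto
  qed
  have der_q: "(q has_derivative (\<lambda>h. g x \<bullet> h)) (at x)" for x
  proof -
    have "(q has_derivative
        blinfun_apply (integral (cbox 0 1) (\<lambda>t. Blinfun (E x t)))) (at x within UNIV)"
      unfolding q_def[abs_def]
    proof (rule leibniz_rule)
      show "(\<lambda>t. g (t *\<^sub>R x) \<bullet> x) integrable_on cbox 0 (1::real)" for x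
        by (intro integrable_continuous continuous_intros continuous_on_compose2[OF contg]) auto
    qed (auto simp: blE intro: derE contE)
    moreover have "blinfun_apply (integral (cbox 0 1) (\<lambda>t::real. Blinfun (E x t))) = (\<lambda>h. g x \<bullet> h)"
    proof (rule ext)
      fix h
      have "continuous_on (cbox 0 1) (\<lambda>t::real. Blinfun (E x t))"
        using continuous_on_compose2[OF contE[of UNIV], of "cbox 0 1" "\<lambda>t::real. (x, t)"]
        by (simp add: continuous_on_Pair)
      then have "blinfun_apply (integral (cbox 0 1) (\<lambda>t::real. Blinfun (E x t))) h =
          integral (cbox 0 1) (\<lambda>t. blinfun_apply (Blinfun (E x t)) h)"
        by (intro blinfun_apply_integral integrable_continuous)
      also have "\<dots> = integral {0..1} (\<lambda>t. E x t h)"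
        by (simp add: blE)
      also have "\<dots> = g x \<bullet> h"
      proof -
        \<comment> \<open>Closedness enters here: exchanging \<open>h\<close> and \<open>x\<close>
          by \<open>sym\<close> makes \<open>E x t h\<close> the \<open>t\<close>-derivative of t (g
          (t x) . h), whose values at 1 and 0 are \<open>g x \<bullet> h\<close> and 0.\<close>
        have "((\<lambda>t. E x t h) has_integral (1 *\<^sub>R (g (1 *\<^sub>R x) \<bullet> h) - 0 *\<^sub>R (g (0 *\<^sub>R x) \<bullet> h))) {0..1}"
        proof (rule fundamental_theorem_of_calculus)
          fix t :: real
          have "((\<lambda>t. g (t *\<^sub>R x)) has_derivative (\<lambda>s. D (t *\<^sub>R x) (s *\<^sub>R x))) (at t)"
            by (rule has_derivative_compose[OF _ der]) (auto intro!: derivative_eq_intros)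
          then have "((\<lambda>t. t *\<^sub>R (g (t *\<^sub>R x) \<bullet> h)) has_derivative
              (\<lambda>s. t *\<^sub>R (D (t *\<^sub>R x) (s *\<^sub>R x) \<bullet> h) + s *\<^sub>R (g (t *\<^sub>R x) \<bullet> h))) (at t)"
            by (auto intro!: derivative_eq_intros)
          moreover have "t *\<^sub>R (D (t *\<^sub>R x) (s *\<^sub>R x) \<bullet> h) + s *\<^sub>R (g (t *\<^sub>R x) \<bullet> h) = s *\<^sub>R E x t h" for s
            using linear_cmul[OF has_derivative_linear[OF der]] sym[of "t *\<^sub>R x" x h]
            by (simp add: E_def D_def[symmetric] algebra_simps)
          ultimately show "((\<lambda>t. t *\<^sub>R (g (t *\<^sub>R x) \<bullet> h)) has_vector_derivative E x t h) (at t within {0..1})"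
            by (simp add: has_vector_derivative_def has_derivative_at_withinI)
        qed simp
        then show ?thesis by (auto dest: integral_unique)
      qed
      finally show "blinfun_apply (integral (cbox 0 1) (\<lambda>t::real. Blinfun (E x t))) h = g x \<bullet> h" .
    qed
    ultimately show ?thesis by simp
  qed
  obtain R where R: "\<And>x. g x \<noteq> 0 \<Longrightarrow> norm x \<le> R"
    using bdg by (auto simp: bounded_iff)
  define U where "U = - cball (0::'a) R"
  have "connected U" unfolding U_def
    using dim by (intro connected_complement_bounded_convex) auto
  moreover have "(q has_derivative (\<lambda>h. 0)) (at x)" if "x \<in> U" for x
  proof -
    have "g x = 0" using R that by (force simp: U_def)
    then show ?thesis using der_q[of x] by simp
  qed
  ultimately have const: "q x = q y" if "x \<in> U" "y \<in> U" for x y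
    using that by (intro has_derivative_zero_unique_connected[of U q]) (auto simp: U_def)
  obtain c where c: "\<And>x. x \<in> U \<Longrightarrow> q x = c"
    using const by metis
  define p where "p x = q x - c" for x
  have der_p: "(p has_derivative (\<lambda>h. g x \<bullet> h)) (at x)" for x
    unfolding p_def using has_derivative_diff[OF der_q has_derivative_const[of c]] by simp
  have "Ck (Suc k) p" for k
    using g by (intro Ck_SucI[OF der_p])
      (simp add: Cc_infinity_iff Ck_bounded_linear[OF bounded_linear_inner_left])
  moreover have "bounded {x. p x \<noteq> 0}"
    using c by (intro bounded_subset[OF bounded_cball[of 0 R]]) (force simp: p_def U_def)
  ultimately show ?thesis using that der_p Cc_infinityI by blast
qed

section \<open>Hessians and the transform \<open>X1\<close>\<close>

lemma linear_axis_expansion: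
  fixes L :: "real^'n \<Rightarrow> real"
  assumes "linear L"
  shows "L v = (\<Sum>i\<in>UNIV. v $ i * L (axis i 1))"
proof -
  have "L v = L (\<Sum>i\<in>UNIV. v $ i *\<^sub>R axis i 1)"
    by (simp add: basis_expansion scalar_mult_eq_scaleR[symmetric])
  then show ?thesis
    by (simp add: linear_sum[OF assms] linear_cmul[OF assms])
qed

lemma partial_deriv_eq:
  "(g has_derivative g') (at x) \<Longrightarrow> partial_deriv i g x = g' (axis i 1)"
  unfolding partial_deriv_def
  by (rule DERIV_imp_deriv) (rule has_real_derivative_along_line, simp)

text \<open>Contracting the Hessian with \<open>v\<close> and \<open>q\<close> gives the derivative
  in direction \<open>v\<close> of the directional derivative of \<open>h\<close> along
  \<open>q\<close>, a compactly supported function.\<close>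

lemma X1_H1_zero:
  fixes h :: "real^'n \<Rightarrow> real"
  assumes h: "h \<in> Cc_infinity"
  shows "X1 v q (H1 h) x = 0"
proof -
  define d where "d j = partial_deriv j h" for j
  have d: "d j = (\<lambda>x. frechet_derivative h (at x) (axis j 1))" for j
    unfolding d_def by (intro ext partial_deriv_eq Cc_infinity_has_derivative h)
  have dC: "d j \<in> Cc_infinity" for j
    unfolding d by (rule Cc_infinity_derivative[OF h])
  define P where "P y = (\<Sum>j\<in>UNIV. q $ j * d j y)" for y
  define P' where "P' y a = (\<Sum>j\<in>UNIV. q $ j * frechet_derivative (d j) (at y) a)" for y a
  have "(LINT t|lborel. P' (x + t *\<^sub>R v) v) = 0"
  proof (rule line_integral_derivative_zero)
    show "(P has_derivative P' y) (at y)" for y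
      unfolding P_def[abs_def] P'_def[abs_def]
      by (intro has_derivative_sum has_derivative_mult_right Cc_infinity_has_derivative dC)
    show "continuous_on UNIV (\<lambda>y. P' y v)"
      using Cc_infinity_derivative[OF dC] unfolding P'_def Cc_infinity_iff
      by (intro continuous_intros) (auto intro: Ck_continuous)
    have "P y = frechet_derivative h (at y) q" for y
      using linear_axis_expansion[OF has_derivative_linear[OF Cc_infinity_has_derivative[OF h]], of y q]
      by (simp add: P_def d)
    then show "bounded {y. P y \<noteq> 0}"
      using Cc_infinity_derivative[OF h, of q] by (simp add: Cc_infinity_iff)
  qed
  moreover have "(\<Sum>i\<in>UNIV. \<Sum>j\<in>UNIV. H1 h y $ i $ j * v $ i * q $ j) = P' y v" for y
  proof -
    have "H1 h y $ i $ j = frechet_derivative (d j) (at y) (axis i 1)" for i j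
      by (simp add: H1_def d_def[symmetric] partial_deriv_eq[OF Cc_infinity_has_derivative[OF dC]])
    moreover have "frechet_derivative (d j) (at y) v =
        (\<Sum>i\<in>UNIV. v $ i * frechet_derivative (d j) (at y) (axis i 1))" for j
      by (rule linear_axis_expansion) (rule has_derivative_linear[OF Cc_infinity_has_derivative[OF dC]])
    ultimately show ?thesis
      unfolding P'_def by (subst sum.swap) (simp add: sum_distrib_left mult_ac)
  qed
  ultimately show ?thesis by (simp add: X1_def)
qed

text \<open>The integral of a non-integrable function is 0 by default, so additivity rests on
  integrability: as \<open>v\<close> is nonzero, the line meets the support of \<open>f\<close> in a
  bounded set of parameters.\<close>

lemma X1_add:
  assumes f: "f \<in> Cc_infinity" and v: "v \<noteq> 0"
  shows "X1 v (q + r) f x = X1 v q f x + X1 v r f x"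
proof -
  let ?I = "\<lambda>q t. \<Sum>i\<in>UNIV. \<Sum>j\<in>UNIV. f (x + t *\<^sub>R v) $ i $ j * v $ i * q $ j"
  have "integrable lborel (?I q)" for q
  proof (rule integrable_compact_support)
    have "continuous_on UNIV (\<lambda>t. f (x + t *\<^sub>R v))"
      by (rule continuous_on_compose2[of UNIV f]) 
        (use f in \<open>auto simp: Cc_infinity_iff intro!: continuous_intros intro: Ck_continuous\<close>)
    then show "continuous_on UNIV (?I q)"
      by (intro continuous_intros)
    have "bounded {t. f (x + t *\<^sub>R v) \<noteq> 0}"
      using f v by (intro bounded_support_line) (auto simp: Cc_infinity_iff)
    then show "bounded {t. ?I q t \<noteq> 0}"
      by (rule bounded_subset) (auto intro: ccontr)
  qed
  then show ?thesis
    by (simp add: X1_def distrib_left sum.distrib)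
qed

text \<open>The two parts of the polarization set span the whole space.\<close>

lemma X1_vanishes_all_polarizations:
  assumes f: "f \<in> Cc_infinity" and X: "X1_vanishes f" and v: "norm v = 1"
  shows "X1 v q f x = 0"
proof -
  have "(q \<bullet> v) *\<^sub>R v \<in> polarizations v"
    by (simp add: polarizations_def span_base span_scale)
  moreover have "q - (q \<bullet> v) *\<^sub>R v \<in> polarizations v"
    using v by (simp add: polarizations_def orthogonal_comp_def orthogonal_def
        inner_diff_right inner_commute dot_square_norm)
  ultimately have "X1 v ((q \<bullet> v) *\<^sub>R v + (q - (q \<bullet> v) *\<^sub>R v)) f x = 0"
    using X v by (subst X1_add[OF f]) (auto simp: X1_vanishes_def)
  then show ?thesis by simp
qed

text \<open>Links tensors to 1-forms: a basis vector as polarization selects the X-ray transform of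
  one column.\<close>

lemma X1_axis:
  "X1 v (axis j 1) f x = (LINT t|lborel. column j (f (x + t *\<^sub>R v)) \<bullet> v)"
  by (simp add: X1_def axis_def inner_vec_def column_def if_distrib cong: if_cong)

lemma bounded_linear_column: "bounded_linear (\<lambda>A::real^'n^'n. column j A)"
  by (intro linear_conv_bounded_linear[THEN iffD1] linearI) (simp_all add: column_def vec_eq_iff)

lemma bounded_linear_vector_matrix_mult: "bounded_linear (\<lambda>A::real^'n^'n. a v* A)"
  by (intro linear_conv_bounded_linear[THEN iffD1] linearI)
    (simp_all add: vector_matrix_mult_def vec_eq_iff algebra_simps sum.distrib sum_distrib_left)

lemma hessian_potential_if_X1_vanishes:
  fixes f :: "real^'n \<Rightarrow> real^'n^'n"
  assumes n: "CARD('n) \<ge> 2" and f: "f \<in> Cc_infinity"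
    and sym: "\<And>x. f x \<in> elastic1" and X: "X1_vanishes f"
  obtains h where "h \<in> Cc_infinity" "f = H1 h"
proof -
  have dim: "DIM(real^'n) \<ge> 2" using n by simp
  have "\<exists>p. p \<in> Cc_infinity \<and> (\<forall>x. (p has_derivative (\<lambda>a. column j (f x) \<bullet> a)) (at x))" for j
  proof -
    let ?g = "\<lambda>x. column j (f x)"
    have g: "?g \<in> Cc_infinity"
      by (rule Cc_infinity_bounded_linear[OF f bounded_linear_column])
    have "(LINT t|lborel. ?g (x + t *\<^sub>R v) \<bullet> v) = 0" if "norm v = 1" for x v
      using X1_vanishes_all_polarizations[OF f X that] by (simp flip: X1_axis)
    from compactly_supported_potential[OF g dim symmetric_derivative_if_Xray_zero[OF g this]]
    show ?thesis by metis
  qed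
  then obtain p where pC: "\<And>j. p j \<in> Cc_infinity"
    and p: "\<And>j x. (p j has_derivative (\<lambda>a. column j (f x) \<bullet> a)) (at x)"
    by metis
  define G where "G x = (\<chi> j. p j x)" for x
  \<comment> \<open>The columns of \<open>f x\<close> are the gradients of the components of
    \<open>G\<close>, so the direction \<open>a\<close> multiplies the matrix from the left.\<close>
  have G: "(G has_derivative (\<lambda>a. a v* f x)) (at x)" for x
    unfolding has_derivative_componentwise_within[where f = G]
  proof
    fix b :: "real^'n" assume "b \<in> Basis"
    then obtain j where "b = axis j 1" by (auto simp: Basis_vec_def)
    with p[of j x] show "((\<lambda>x. G x \<bullet> b) has_derivative (\<lambda>a. (a v* f x) \<bullet> b)) (at x)"
      by (simp add: G_def inner_axis vector_matrix_mult_def column_def inner_vec_def[of "\<chi> i. f x $ i $ j"] mult_ac)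
  qed
  have "Ck (Suc k) G" for k
    using f by (intro Ck_SucI[OF G])
      (simp add: Cc_infinity_iff Ck_bounded_linear[OF bounded_linear_vector_matrix_mult])
  moreover have "bounded {x. G x \<noteq> 0}"
  proof (rule bounded_subset)
    show "bounded (\<Union>j. {x. p j x \<noteq> 0})"
      using pC by (auto simp: Cc_infinity_iff)
  qed (auto simp: G_def vec_eq_iff)
  ultimately have GC: "G \<in> Cc_infinity" by (rule Cc_infinityI)
  have fsym: "f x $ i $ j = f x $ j $ i" for x i j
    using sym[of x] by (simp add: elastic1_def)
  \<comment> \<open>Closedness of \<open>G\<close> as a 1-form is exactly the symmetry of the
    matrices \<open>f x\<close>.\<close>
  have "frechet_derivative G (at x) a \<bullet> b = frechet_derivative G (at x) b \<bullet> a" for x a b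
  proof -
    have "(a v* f x) \<bullet> b = (\<Sum>j\<in>UNIV. \<Sum>i\<in>UNIV. f x $ i $ j * a $ i * b $ j)"
      by (simp add: vector_matrix_mult_def inner_vec_def sum_distrib_left mult_ac)
    also have "\<dots> = (\<Sum>j\<in>UNIV. \<Sum>i\<in>UNIV. f x $ i $ j * b $ i * a $ j)"
      by (subst sum.swap) (simp add: fsym[of x] mult_ac)
    also have "\<dots> = (b v* f x) \<bullet> a"
      by (simp add: vector_matrix_mult_def inner_vec_def sum_distrib_left mult_ac)
    finally show ?thesis by (simp add: frechet_derivative_eqI[OF G])
  qed
  then obtain h where h: "h \<in> Cc_infinity" "\<And>x. (h has_derivative (\<lambda>a. G x \<bullet> a)) (at x)"
    using compactly_supported_potential[OF GC dim] by metis
  have "partial_deriv j h = p j" for j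
    using partial_deriv_eq[OF h(2)] by (simp add: fun_eq_iff inner_axis G_def)
  moreover have "partial_deriv i (p j) x = f x $ i $ j" for i j x
    using partial_deriv_eq[OF p] by (simp add: inner_axis column_def)
  ultimately have "f = H1 h"
    by (intro ext) (simp add: H1_def vec_eq_iff)
  with h(1) show ?thesis by (rule that)
qed

theorem theorem1:
  fixes f :: "real^'n \<Rightarrow> real^'n^'n"
  assumes "CARD('n) \<ge> 2"
    and "f \<in> Cc_infinity"
    and "\<And>x. f x \<in> elastic1"
  shows "X1_vanishes f \<longleftrightarrow> (\<exists>h \<in> Cc_infinity. f = H1 h)"
proof
  assume "X1_vanishes f"
  with assms show "\<exists>h \<in> Cc_infinity. f = H1 h"
    by (metis hessian_potential_if_X1_vanishes)
next
  assume "\<exists>h \<in> Cc_infinity. f = H1 h"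
  then show "X1_vanishes f"
    by (auto simp: X1_vanishes_def X1_H1_zero)
qed

end
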